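(* Let $k$ be a field and let $J=J(\Delta)\subseteq R=k[x_1,\ldots,x_n]$ be the cover ideal of a loopless matroid $\Delta$ of rank $c$ on $[n]$. If $\Delta$ is not a uniform matroid, then, with $u=\operatorname{ut}(\Delta)$, $$\widehat\alpha(J)=\min\left\{\alpha(J),\ \frac{\alpha(SF_2(J))}{2},\ \ldots,\ \frac{\alpha(SF_{u-1}(J))}{u-1},\ \frac nc\right\}.$$
   Context: A matroid on $[n]$ is identified with the simplicial complex whose facets are its bases. The cover ideal is $J(\Delta)=\bigcap_F(x_i:i\in F)$, intersection over the bases $F$. For a squarefree monomial ideal $J$, $J^{(\ell)}=\bigcap_{\mathfrak p\in\operatorname{Ass}(R/J)}\mathfrak p^\ell$, and $SF_\ell(J)$ is the ideal generated by all squarefree monomials in $J^{(\ell)}$ (so $SF_1(J)=J$). For a nonzero homogeneous ideal $L$, $\alpha(L)$ is the smallest degree of a nonzero element of $L$; $\widehat\alpha(J)=\lim_{\ell\to\infty}\alpha(J^{(\ell)})/\ell$ is the Waldschmidt constant. For a pure simplicial complex $\Delta$ on $[n]$ of dimension $c-1$ (facets of size $c\ge 1$), the uniformity threshold $\operatorname{ut}(\Delta)$ is the minimum integer $u$ with $1\le u\le c$ such that the codimension-$(u-1)$ skeleton of $\Delta$, i.e. the complex of all faces of $\Delta$ of size at most $c-u+1$, is a uniform matroid on $[n]$, i.e. consists of all subsets of $[n]$ of size at most $c-u+1$ (and $\operatorname{ut}(\Delta)=\infty$ if no such $u$ exists; for a loopless matroid $\operatorname{ut}(\Delta)\le c$,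 and for a non-uniform one $\operatorname{ut}(\Delta)\ge2$). *)

theory Defs
  imports
    "HOL-Library.Poly_Mapping"
    "HOL-Library.Extended_Nat"
    "HOL-Algebra.Ideal_Product"
    "HOL-Algebra.QuotRing"
    "HOL-Algebra.Algebraic_Closure_Type"
begin

text \<open>
  The ground set \<open>[n]\<close> is the universe of a finite type \<open>'n\<close>, so \<open>n = card (UNIV :: 'n set)\<close>.
\<close>

subsection \<open>Simplicial complexes and matroids\<close>

definition simplicial_complex :: "'n set set \<Rightarrow> bool" where
  "simplicial_complex \<Delta> \<longleftrightarrow> \<Delta> \<noteq> {} \<and> (\<forall>A\<in>\<Delta>. \<forall>B. B \<subseteq> A \<longrightarrow> B \<in> \<Delta>)"

definition facets :: "'n set set \<Rightarrow> 'n set set" where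
  "facets \<Delta> = {F \<in> \<Delta>. \<forall>G\<in>\<Delta>. F \<subseteq> G \<longrightarrow> F = G}"

text \<open>
  A matroid is given by its complex of independent sets; its bases are the facets.
\<close>

definition matroid :: "'n::finite set set \<Rightarrow> bool" where
  "matroid \<Delta> \<longleftrightarrow> simplicial_complex \<Delta> \<and>
     (\<forall>A\<in>\<Delta>. \<forall>B\<in>\<Delta>. card A < card B \<longrightarrow> (\<exists>x\<in>B - A. insert x A \<in> \<Delta>))"

definition loopless :: "'n set set \<Rightarrow> bool" where
  "loopless \<Delta> \<longleftrightarrow> (\<forall>x. {x} \<in> \<Delta>)"

text \<open>
  The largest size of a face: the dimension plus one, and the rank if \<open>\<Delta>\<close> is a matroid.
\<close>

definition complex_rank :: "'n::finite set set \<Rightarrow> nat" where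
  "complex_rank \<Delta> = Max (card ` \<Delta>)"

definition uniform_matroid_of_rank :: "nat \<Rightarrow> 'n::finite set set" where
  "uniform_matroid_of_rank r = {A. card A \<le> r}"

definition is_uniform_matroid :: "'n::finite set set \<Rightarrow> bool" where
  "is_uniform_matroid \<Delta> \<longleftrightarrow> (\<exists>r. \<Delta> = uniform_matroid_of_rank r)"

definition codim_skeleton :: "nat \<Rightarrow> 'n::finite set set \<Rightarrow> 'n set set" where
  "codim_skeleton d \<Delta> = {A \<in> \<Delta>. card A \<le> complex_rank \<Delta> - d}"

text \<open>The infimum of the empty set is \<open>\<infinity>\<close> in \<^typ>\<open>enat\<close>.\<close>

definition uniformity_threshold :: "'n::finite set set \<Rightarrow> enat" where
  "uniformity_threshold \<Delta> =
     (INF u \<in> {u. 1 \<le> u \<and> u \<le> complex_rank \<Delta> \<and>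
       codim_skeleton (u - 1) \<Delta> = uniform_matroid_of_rank (complex_rank \<Delta> - u + 1)}. enat u)"

lemma uniformity_threshold_le_rank:
  assumes "matroid \<Delta>" "loopless \<Delta>"
  shows "uniformity_threshold \<Delta> \<le> enat (complex_rank \<Delta>)"
proof -
  have sc: "simplicial_complex \<Delta>" using assms(1) by (simp add: matroid_def)
  have sing: "{x} \<in> \<Delta>" for x using assms(2) by (simp add: loopless_def)
  have small: "A \<in> \<Delta>" if "card A \<le> Suc 0" for A
  proof (cases "card A = 0")
    case True
    then have "A = {}" by simp
    then show ?thesis using sc sing unfolding simplicial_complex_def by blast
  next
    case False
    then have "card A = 1" using that by linarith
    then show ?thesis using sing by (auto simp: card_1_singleton_iff)
  qed
  have "card {undefined :: 'a} \<le> complex_rank \<Delta>"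
    unfolding complex_rank_def by (intro Max_ge imageI sing) simp
  then have pos: "1 \<le> complex_rank \<Delta>" by simp
  then have "codim_skeleton (complex_rank \<Delta> - 1) \<Delta> = uniform_matroid_of_rank 1"
    using small by (auto simp: codim_skeleton_def uniform_matroid_of_rank_def)
  with pos show ?thesis
    unfolding uniformity_threshold_def by (intro INF_lower) simp
qed


subsection \<open>Symbolic powers\<close>

text \<open>
  \<open>Ass\<^sub>R(R/J)\<close>: the primes of \<open>R\<close> that are annihilators of elements of \<open>R/J\<close>.
\<close>

definition associated_primes :: "('a, 'b) ring_scheme \<Rightarrow> 'a set \<Rightarrow> 'a set set" where
  "associated_primes R J =
     {P. primeideal P R \<and>
       (\<exists>m \<in> carrier (R Quot J).
         P = {r \<in> carrier R. (J +>\<^bsub>R\<^esub> r) \<otimes>\<^bsub>R Quot J\<^esub> m = \<zero>\<^bsub>R Quot J\<^esub>})}"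

definition symbolic_power :: "('a, 'b) ring_scheme \<Rightarrow> 'a set \<Rightarrow> nat \<Rightarrow> 'a set" where
  "symbolic_power R J l =
     carrier R \<inter> (\<Inter>P \<in> associated_primes R J. P [^]\<^bsub>ideals_set R\<^esub> l)"


subsection \<open>The polynomial ring\<close>

text \<open>
  An exponent vector is an element of \<open>'n \<Rightarrow>\<^sub>0 nat\<close>; a polynomial in \<open>k[x\<^sub>i : i \<in> 'n]\<close> maps
  exponent vectors to coefficients, and multiplication is convolution.
\<close>

type_synonym ('n, 'k) mpoly = "('n \<Rightarrow>\<^sub>0 nat) \<Rightarrow>\<^sub>0 'k"

abbreviation mpoly_ring :: "('n, 'k::field) mpoly ring" where
  "mpoly_ring \<equiv> ring_of_type_algebra"

definition monomial :: "('n \<Rightarrow>\<^sub>0 nat) \<Rightarrow> ('n, 'k::field) mpoly" where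
  "monomial a = Poly_Mapping.single a 1"

definition variable :: "'n \<Rightarrow> ('n, 'k::field) mpoly" where
  "variable i = monomial (Poly_Mapping.single i 1)"

definition squarefree_exponent :: "('n \<Rightarrow>\<^sub>0 nat) \<Rightarrow> bool" where
  "squarefree_exponent a \<longleftrightarrow> (\<forall>i. Poly_Mapping.lookup a i \<le> 1)"

text \<open>Only meaningful for nonzero polynomials.\<close>

definition total_degree :: "('n::finite, 'k::field) mpoly \<Rightarrow> nat" where
  "total_degree f = Max ((\<lambda>a. \<Sum>i\<in>UNIV. Poly_Mapping.lookup a i) ` Poly_Mapping.keys f)"

text \<open>The invariant \<open>\<alpha>(L)\<close> of a nonzero homogeneous ideal \<open>L\<close>.\<close>

definition initial_degree :: "('n::finite, 'k::field) mpoly set \<Rightarrow> nat" where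
  "initial_degree L = (LEAST d. \<exists>f\<in>L. f \<noteq> 0 \<and> total_degree f = d)"

definition waldschmidt_constant :: "('n::finite, 'k::field) mpoly set \<Rightarrow> real" where
  "waldschmidt_constant J =
     lim (\<lambda>l. real (initial_degree (symbolic_power mpoly_ring J l)) / real l)"

definition cover_ideal :: "'n set set \<Rightarrow> ('n, 'k::field) mpoly set" where
  "cover_ideal \<Delta> = (\<Inter>F \<in> facets \<Delta>. Idl\<^bsub>mpoly_ring\<^esub> (variable ` F))"

text \<open>The ideal \<open>SF\<^sub>l(J)\<close>.\<close>

definition squarefree_monomial_ideal :: "nat \<Rightarrow> ('n, 'k::field) mpoly set \<Rightarrow> ('n, 'k) mpoly set" where
  "squarefree_monomial_ideal l J =
     Idl\<^bsub>mpoly_ring\<^esub>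
       {monomial a | a. squarefree_exponent a \<and> monomial a \<in> symbolic_power mpoly_ring J l}"

end

theory Submission
  imports Defs
begin

text \<open>
  The associated primes of \<open>J\<close> are the ideals generated by the variables of a basis, so a monomial
  lies in \<open>J\<^sup>(\<^sup>l\<^sup>)\<close> iff its exponent vector has weight at least \<open>l\<close> on every basis. Let \<open>d\<^sub>j\<close> be the
  minimum size of a set that meets every basis in at least \<open>j\<close> elements; then \<open>d\<^sub>j = \<alpha>(SF\<^sub>j(J))\<close>.
  Multiples of indicator vectors give \<open>\<alpha>(J\<^sup>(\<^sup>l\<^sup>)) / l \<le> d\<^sub>j / j + O(1/l)\<close>. Conversely, an exponent vector is
  the sum of the indicators of its superlevel sets, and a basis of minimum weight meets all of them
  in the least possible number of elements at the same time; hence the Waldschmidt constant is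
  \<open>min\<^sub>j d\<^sub>j / j\<close> over \<open>1 \<le> j \<le> c\<close>. For \<open>j \<ge> u\<close> all sets of size \<open>c - j + 1\<close> are independent, so
  \<open>d\<^sub>j = n - c + j\<close>, and \<open>(n - c + j) / j\<close> is decreasing in \<open>j\<close> with minimum \<open>n / c\<close>.
\<close>

section \<open>Matroids\<close>

lemma matroid_subset_closed:
  assumes "matroid \<Delta>" "A \<in> \<Delta>" "B \<subseteq> A"
  shows "B \<in> \<Delta>"
  using assms unfolding matroid_def simplicial_complex_def by blast

text \<open>Iterates the exchange axiom until the sizes agree. The containment in
  \<open>I \<union> B\<close> records that all new elements come from \<open>B\<close>; the exchange
  in \<open>greedy_basis\<close> depends on it.\<close>

lemma matroid_augment:
  assumes "matroid \<Delta>" "I \<in> \<Delta>" "B \<in> \<Delta>" "card I \<le> card B"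
  obtains I' where "I' \<in> \<Delta>" "I \<subseteq> I'" "I' \<subseteq> I \<union> B" "card I' = card B"
  using assms(2,4)
proof (induction "card B - card I" arbitrary: I thesis)
  case 0
  then have "card I = card B" by simp
  with 0 show ?case by blast
next
  case (Suc k)
  then obtain x where x: "x \<in> B - I" "insert x I \<in> \<Delta>"
    using assms(1,3) unfolding matroid_def by fastforce
  then have "card (insert x I) = Suc (card I)" by simp
  with Suc.hyps(2) have "k = card B - card (insert x I)" "card (insert x I) \<le> card B"
    by auto
  from Suc.hyps(1)[OF this(1) _ x(2) this(2)]
  obtain I' where "I' \<in> \<Delta>" "insert x I \<subseteq> I'" "I' \<subseteq> insert x I \<union> B" "card I' = card B"
    by blast
  then show ?case using x(1) Suc.prems(1)[of I'] by blast
qed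

text \<open>A maximal face smaller than a largest face \<open>B\<close> could be augmented from
  \<open>B\<close>, so maximality by inclusion and by size agree.\<close>

lemma facets_of_matroid:
  assumes "matroid \<Delta>"
  shows "facets \<Delta> = {F \<in> \<Delta>. card F = complex_rank \<Delta>}"
proof -
  have ne: "\<Delta> \<noteq> {}" using assms by (auto simp: matroid_def simplicial_complex_def)
  have le: "card A \<le> complex_rank \<Delta>" if "A \<in> \<Delta>" for A
    unfolding complex_rank_def using that by (intro Max_ge) auto
  have "complex_rank \<Delta> \<in> card ` \<Delta>"
    unfolding complex_rank_def using ne by (intro Max_in) auto
  then obtain B where B: "B \<in> \<Delta>" "card B = complex_rank \<Delta>" by auto
  have "card F = complex_rank \<Delta>" if F: "F \<in> facets \<Delta>" for F
  proof -
    have FD: "F \<in> \<Delta>" and max: "\<And>G. G \<in> \<Delta> \<Longrightarrow> F \<subseteq> G \<Longrightarrow> F = G"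
      using F by (auto simp: facets_def)
    have "card F \<le> card B" using B(2) le[OF FD] by simp
    from matroid_augment[OF assms FD B(1) this] show ?thesis
      using max B(2) by metis
  qed
  moreover have "F \<in> facets \<Delta>" if "F \<in> \<Delta>" "card F = complex_rank \<Delta>" for F
    using that le card_seteq[OF finite, of F] by (auto simp: facets_def)
  ultimately show ?thesis by (auto simp: facets_def)
qed

lemma matroid_facet_extends:
  assumes "matroid \<Delta>" "I \<in> \<Delta>"
  obtains F where "F \<in> facets \<Delta>" "I \<subseteq> F"
proof -
  have "complex_rank \<Delta> \<in> card ` \<Delta>"
    unfolding complex_rank_def using assms(2) by (intro Max_in) auto
  then obtain B where B: "B \<in> \<Delta>" "card B = complex_rank \<Delta>" by auto
  have "card I \<le> complex_rank \<Delta>"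
    unfolding complex_rank_def using assms(2) by (intro Max_ge) auto
  with B(2) have "card I \<le> card B" by simp
  from assms B(1) this obtain F
    where F: "F \<in> \<Delta>" "I \<subseteq> F" "F \<subseteq> I \<union> B" "card F = card B"
    by (rule matroid_augment)
  then have "F \<in> facets \<Delta>" using B(2) facets_of_matroid[OF assms(1)] by simp
  then show ?thesis using F(2) by (rule that)
qed

lemma facets_nonempty:
  assumes "matroid \<Delta>"
  shows "facets \<Delta> \<noteq> {}"
proof -
  obtain I where "I \<in> \<Delta>" using assms by (auto simp: matroid_def simplicial_complex_def)
  then show ?thesis using matroid_facet_extends[OF assms] by blast
qed

lemma loopless_rank_pos:
  fixes \<Delta> :: "'n::finite set set"
  assumes "loopless \<Delta>"
  shows "1 \<le> complex_rank \<Delta>"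
proof -
  have "card {undefined :: 'n} \<le> complex_rank \<Delta>"
    unfolding complex_rank_def using assms by (intro Max_ge imageI) (auto simp: loopless_def)
  then show ?thesis by simp
qed

text \<open>A basis of minimum weight works: otherwise a basis exchange would lower the weight.\<close>

lemma greedy_basis:
  fixes \<Delta> :: "'n::finite set set" and y :: "'n \<Rightarrow> nat"
  assumes "matroid \<Delta>"
  obtains F where "F \<in> facets \<Delta>"
    "\<And>t G. G \<in> facets \<Delta> \<Longrightarrow> card ({i. t < y i} \<inter> F) \<le> card ({i. t < y i} \<inter> G)"
proof -
  define F where "F = arg_min_on (sum y) (facets \<Delta>)"
  have F: "F \<in> facets \<Delta>" and min: "\<And>G. G \<in> facets \<Delta> \<Longrightarrow> sum y F \<le> sum y G"
    unfolding F_def using facets_nonempty[OF assms]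
    by (auto intro: arg_min_if_finite(1) arg_min_least)
  have "card ({i. t < y i} \<inter> F) \<le> card ({i. t < y i} \<inter> G)" if G: "G \<in> facets \<Delta>" for t G
  proof (rule ccontr)
    let ?T = "{i. y i \<le> t}"
    assume "\<not> ?thesis"
    \<comment> \<open>\<open>?T\<close> is the complement of the superlevel set and all bases have
      the same size, so a surplus of \<open>F\<close> above level \<open>t\<close> is a deficit of
      \<open>F\<close> in \<open>?T\<close>.\<close>
    moreover have split: "card ({i. t < y i} \<inter> H) + card (?T \<inter> H) = card H" for H
      by (subst card_Un_disjoint[symmetric]) (auto intro: arg_cong[of _ _ card])
    moreover have FG: "F \<in> \<Delta>" "G \<in> \<Delta>" "card F = card G"
      using F G facets_of_matroid[OF assms] by auto
    ultimately have "card (?T \<inter> F) < card (?T \<inter> G)"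
      using split[of F] split[of G] by linarith
    moreover have ind: "?T \<inter> F \<in> \<Delta>" "?T \<inter> G \<in> \<Delta>"
      using matroid_subset_closed[OF assms] FG by (meson Int_lower2)+
    ultimately obtain x where x: "x \<in> ?T \<inter> G - ?T \<inter> F" and xI: "insert x (?T \<inter> F) \<in> \<Delta>"
      using assms unfolding matroid_def by blast
    \<comment> \<open>\<open>F\<close> has an element outside \<open>?T\<close>, so adding
      \<open>x\<close> gives at most \<open>card F\<close> elements, and the result can be completed
      to a basis \<open>H\<close> with elements of \<open>F\<close> alone.\<close>
    have "\<not> F \<subseteq> ?T \<inter> F"
    proof
      assume "F \<subseteq> ?T \<inter> F"
      then have "?T \<inter> F = F" by blast
      with \<open>card (?T \<inter> F) < card (?T \<inter> G)\<close> FG(3) show False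
        by (metis card_mono finite Int_lower2 not_less)
    qed
    then have "card (?T \<inter> F) < card F" by (intro psubset_card_mono) auto
    then have "card (insert x (?T \<inter> F)) \<le> card F" using x by simp
    from matroid_augment[OF assms xI FG(1) this] obtain H where H: "H \<in> \<Delta>"
      "insert x (?T \<inter> F) \<subseteq> H" "H \<subseteq> insert x (?T \<inter> F) \<union> F" "card H = card F"
      by blast
    have HF: "H \<in> facets \<Delta>"
      using H F facets_of_matroid[OF assms] by auto
    have xF: "x \<notin> F" "x \<in> H" "y x \<le> t" using x H(2) by auto
    have "card (H - {x}) < card F"
      using H(4) xF by (metis card_Diff1_less finite)
    then have "\<not> F \<subseteq> H - {x}"
      by (metis card_mono finite not_less)
    then obtain z where z: "z \<in> F" "z \<notin> H" using xF by blast
    have "z \<notin> ?T \<inter> F" using H(2) z(2) by blast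
    then have zt: "t < y z" using z(1) by auto
    \<comment> \<open>\<open>H\<close> is \<open>F\<close> with \<open>z\<close> exchanged for
      \<open>x\<close>. Since \<open>H\<close> contains \<open>?T \<inter> F\<close>, the removed
      \<open>z\<close> has weight above \<open>t\<close>, whereas \<open>x\<close> has weight at
      most \<open>t\<close>.\<close>
    have "H - {x} = F - {z}"
    proof (rule card_subset_eq)
      show "H - {x} \<subseteq> F - {z}" using H(3) z by blast
      show "card (H - {x}) = card (F - {z})" using H(4) xF z by simp
    qed simp
    then have "sum y H - y x = sum y F - y z"
      using xF(2) z(1) sum_diff1_nat[of y H x] sum_diff1_nat[of y F z] by simp
    moreover have "y x \<le> sum y H" "y z \<le> sum y F"
      using xF(2) z(1) by (simp_all add: member_le_sum)
    ultimately have "sum y H < sum y F" using xF(3) zt by linarith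
    with min[OF HF] show False by simp
  qed
  with F that show ?thesis by blast
qed

text \<open>The number \<open>y i\<close> counts the levels \<open>t < y i\<close>; interchanging
  the two sums groups the count by levels instead of by elements.\<close>

lemma sum_layer_cake:
  fixes y :: "'n \<Rightarrow> nat"
  assumes "finite A" "\<And>i. i \<in> A \<Longrightarrow> y i \<le> N"
  shows "sum y A = (\<Sum>t<N. card ({i. t < y i} \<inter> A))"
proof -
  have "y i = (\<Sum>t<N. if t < y i then 1 else 0)" if "i \<in> A" for i
  proof -
    have "{..<N} \<inter> {t. t < y i} = {..<y i}" using assms(2)[OF that] by auto
    then show ?thesis by (simp add: sum.If_cases)
  qed
  then have "sum y A = (\<Sum>i\<in>A. \<Sum>t<N. if t < y i then 1 else 0)"
    by (rule sum.cong[OF refl])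
  also have "\<dots> = (\<Sum>t<N. \<Sum>i\<in>A. if t < y i then 1 else 0)"
    by (rule sum.swap)
  also have "\<dots> = (\<Sum>t<N. card ({i. t < y i} \<inter> A))"
    using assms(1) by (intro sum.cong) (auto simp: sum.If_cases Int_commute)
  finally show ?thesis .
qed

section \<open>Multiple covers of the bases and the uniformity threshold\<close>

text \<open>For a matroid these are the supports of the squarefree monomials in the
  \<open>j\<close>-th symbolic power of the cover ideal.\<close>

definition is_cover :: "'n set set \<Rightarrow> nat \<Rightarrow> 'n set \<Rightarrow> bool" where
  "is_cover \<Delta> j S \<longleftrightarrow> (\<forall>F\<in>facets \<Delta>. j \<le> card (S \<inter> F))"

text \<open>Cut the weight into superlevel sets and evaluate the hypothesis on a greedy basis.\<close>

lemma weighted_cover_bound: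
  fixes \<Delta> :: "'n::finite set set" and y :: "'n \<Rightarrow> nat" and m :: real
  assumes "matroid \<Delta>"
    and cover: "\<And>j S. 1 \<le> j \<Longrightarrow> j \<le> complex_rank \<Delta> \<Longrightarrow> is_cover \<Delta> j S \<Longrightarrow>
      m * real j \<le> real (card S)"
    and "0 \<le> m"
    and l: "\<And>F. F \<in> facets \<Delta> \<Longrightarrow> l \<le> sum y F"
  shows "m * real l \<le> real (sum y UNIV)"
proof -
  obtain F where F: "F \<in> facets \<Delta>"
    and greedy: "\<And>t G. G \<in> facets \<Delta> \<Longrightarrow> card ({i. t < y i} \<inter> F) \<le> card ({i. t < y i} \<inter> G)"
    by (rule greedy_basis[OF assms(1), of y]) blast
  define N where "N = Max (range y)"
  have N: "y i \<le> N" for i unfolding N_def by (intro Max_ge) auto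
  have "m * real l \<le> m * real (sum y F)"
    using l[OF F] \<open>0 \<le> m\<close> by (intro mult_left_mono of_nat_mono)
  also have "\<dots> = (\<Sum>t<N. m * real (card ({i. t < y i} \<inter> F)))"
    by (simp add: sum_layer_cake[OF finite N] sum_distrib_left)
  also have "\<dots> \<le> (\<Sum>t<N. real (card ({i. t < y i} \<inter> UNIV)))"
  proof (rule sum_mono)
    fix t
    have "card ({i. t < y i} \<inter> F) \<le> complex_rank \<Delta>"
      using F facets_of_matroid[OF assms(1)] card_mono[of F "{i. t < y i} \<inter> F"] by auto
    \<comment> \<open>Since \<open>F\<close> is greedy, the superlevel set meets every basis at
      least as often as it meets \<open>F\<close>, so it is a cover for that multiplicity.
      Multiplicity 0 lies outside the range of \<open>cover\<close> and is trivial.\<close>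
    then show "m * real (card ({i. t < y i} \<inter> F)) \<le> real (card ({i. t < y i} \<inter> UNIV))"
      using cover[of "card ({i. t < y i} \<inter> F)" "{i. t < y i}"] greedy
      by (cases "card ({i. t < y i} \<inter> F) = 0") (auto simp: is_cover_def)
  qed
  also have "\<dots> = real (sum y UNIV)"
    by (simp add: sum_layer_cake[OF finite N])
  finally show ?thesis .
qed

text \<open>Write \<open>c\<close> for the rank. If \<open>S\<close> missed \<open>c - j + 1\<close>
  elements, these would be independent because \<open>j \<ge> u\<close>; a basis containing them has
  room for only \<open>j - 1\<close> elements of \<open>S\<close>.\<close>

lemma cover_card_above_threshold:
  fixes \<Delta> :: "'n::finite set set"
  assumes "matroid \<Delta>"
    and skel: "codim_skeleton (u - 1) \<Delta> = uniform_matroid_of_rank (complex_rank \<Delta> - u + 1)"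
    and "1 \<le> u" "u \<le> j" "j \<le> complex_rank \<Delta>"
    and cover: "is_cover \<Delta> j S"
  shows "card (UNIV :: 'n set) + j \<le> card S + complex_rank \<Delta>"
proof (rule ccontr)
  assume "\<not> ?thesis"
  moreover have "card S + card (- S) = card (UNIV :: 'n set)"
    using card_Un_disjoint[of S "- S"] by (simp add: Compl_partition)
  ultimately have "complex_rank \<Delta> - j + 1 \<le> card (- S)" using assms(5) by linarith
  then obtain T where T: "T \<subseteq> - S" "card T = complex_rank \<Delta> - j + 1"
    by (meson obtain_subset_with_card_n)
  then have "T \<in> uniform_matroid_of_rank (complex_rank \<Delta> - u + 1)"
    using assms(4) by (simp add: uniform_matroid_of_rank_def)
  then have "T \<in> \<Delta>" using skel by (auto simp: codim_skeleton_def)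
  then obtain F where F: "F \<in> facets \<Delta>" "T \<subseteq> F"
    using matroid_facet_extends[OF assms(1)] by blast
  have "card (S \<inter> F) + card T = card ((S \<inter> F) \<union> T)"
    using T(1) by (subst card_Un_disjoint) auto
  also have "\<dots> \<le> card F" using F(2) by (intro card_mono) auto
  also have "card F = complex_rank \<Delta>" using F(1) facets_of_matroid[OF assms(1)] by auto
  finally have "card (S \<inter> F) < j" using T(2) assms(5) by linarith
  then show False using cover F(1) by (auto simp: is_cover_def)
qed

text \<open>A finite infimum in \<open>enat\<close> means that the set of candidates is nonempty,
  and by well-ordering the infimum is then one of them.\<close>

lemma uniformity_threshold_attained:
  assumes "uniformity_threshold \<Delta> = enat u"
  shows "1 \<le> u" "u \<le> complex_rank \<Delta>"
    "codim_skeleton (u - 1) \<Delta> = uniform_matroid_of_rank (complex_rank \<Delta> - u + 1)"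
proof -
  let ?U = "{u. 1 \<le> u \<and> u \<le> complex_rank \<Delta> \<and>
       codim_skeleton (u - 1) \<Delta> = uniform_matroid_of_rank (complex_rank \<Delta> - u + 1)}"
  have eq: "Inf (enat ` ?U) = enat u" using assms by (simp add: uniformity_threshold_def)
  then have "enat ` ?U \<noteq> {}" by (metis Inf_enat_def enat.simps(3) infinity_enat_def)
  then have "Inf (enat ` ?U) \<in> enat ` ?U"
    by (metis (no_types, lifting) Inf_enat_def LeastI_ex ex_in_conv)
  with eq have "u \<in> ?U" by auto
  then show "1 \<le> u" "u \<le> complex_rank \<Delta>"
    "codim_skeleton (u - 1) \<Delta> = uniform_matroid_of_rank (complex_rank \<Delta> - u + 1)" by auto
qed

section \<open>Associated primes of an intersection of primes\<close>

text \<open>Every element of the quotient is a coset of some \<open>s\<close>, so its annihilator is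
  the colon ideal of \<open>I\<close> by \<open>s\<close>; this removes the quotient ring from later
  arguments.\<close>

lemma (in ideal) associated_primes_eq:
  "associated_primes R I =
     {P. primeideal P R \<and> (\<exists>s \<in> carrier R. P = {r \<in> carrier R. r \<otimes> s \<in> I})}"
proof -
  have coset: "(I +> r) \<otimes>\<^bsub>R Quot I\<^esub> (I +> s) = \<zero>\<^bsub>R Quot I\<^esub> \<longleftrightarrow> r \<otimes> s \<in> I"
    if "r \<in> carrier R" "s \<in> carrier R" for r s
  proof -
    have "(I +> r) \<otimes>\<^bsub>R Quot I\<^esub> (I +> s) = I +> (r \<otimes> s)"
      using that by (simp add: FactRing_def rcoset_mult_add)
    moreover have "I +> (r \<otimes> s) = I \<longleftrightarrow> r \<otimes> s \<in> I"
      using that a_coset_join2[of "r \<otimes> s" I] a_coset_join1[of I "r \<otimes> s"] a_subgroup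
      by (metis a_rcos_zero is_ideal a_rcos_self m_closed)
    ultimately show ?thesis by (simp add: FactRing_def)
  qed
  have carr: "carrier (R Quot I) = (\<lambda>s. I +> s) ` carrier R"
    by (auto simp: FactRing_simps)
  show ?thesis
    unfolding associated_primes_def carr
    by (auto simp: coset cong: conj_cong)
qed

text \<open>If no member lay inside the prime, a product of elements witnessing this would be in the
  intersection but outside the prime. Intersecting with \<open>carrier R\<close> gives the empty
  family its proper meaning.\<close>

lemma (in primeideal) Inter_subset_prime:
  assumes "finite S" "\<And>Q. Q \<in> S \<Longrightarrow> ideal Q R" "carrier R \<inter> \<Inter>S \<subseteq> I"
  shows "\<exists>Q\<in>S. Q \<subseteq> I"
  using assms
proof (induction S rule: finite_induct)
  case empty
  then show ?case using I_notcarr a_subset by auto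
next
  case (insert Q S)
  show ?case
  proof (rule ccontr)
    assume no: "\<not> ?case"
    then obtain q where q: "q \<in> Q" "q \<notin> I" by blast
    from no insert.IH[OF insert.prems(1)] have "\<not> carrier R \<inter> \<Inter>S \<subseteq> I" by blast
    then obtain s where s: "s \<in> carrier R" "s \<in> \<Inter>S" "s \<notin> I" by blast
    have qc: "q \<in> carrier R" using ideal.Icarr[OF insert.prems(1) q(1)] by simp
    have "q \<otimes> s \<in> Q" using ideal.I_r_closed[OF insert.prems(1) q(1) s(1)] by simp
    moreover have "q \<otimes> s \<in> P" if "P \<in> S" for P
      using ideal.I_l_closed[OF insert.prems(1) _ qc, of P] that s(2) by simp
    ultimately have "q \<otimes> s \<in> I" using insert.prems(2) qc s(1) by auto
    then show False using I_prime[OF qc s(1)] q s by blast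
  qed
qed

text \<open>As the members are prime, the annihilator of the class of \<open>s\<close> is the
  intersection of those members that do not contain \<open>s\<close>.\<close>

lemma (in cring) associated_primes_Inter:
  assumes fin: "finite S" and ne: "S \<noteq> {}" and prime: "\<And>P. P \<in> S \<Longrightarrow> primeideal P R"
    and antichain: "\<And>P Q. P \<in> S \<Longrightarrow> Q \<in> S \<Longrightarrow> P \<subseteq> Q \<Longrightarrow> P = Q"
  shows "associated_primes R (\<Inter>S) = S"
proof -
  have ideal: "ideal P R" if "P \<in> S" for P
    using prime[OF that] by (rule primeideal.axioms)
  interpret J: ideal "\<Inter>S" R
    using ne ideal by (intro i_Intersect) auto
  have "P \<in> S" if P: "primeideal P R" and s: "s \<in> carrier R"
    and eq: "P = {r \<in> carrier R. r \<otimes> s \<in> \<Inter>S}" for P s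
  proof -
    have mem: "r \<otimes> s \<in> Q \<longleftrightarrow> s \<in> Q \<or> r \<in> Q" if "Q \<in> S" "r \<in> carrier R" for r Q
      using primeideal.I_prime[OF prime[OF that(1)] that(2) s] ideal.I_l_closed[OF ideal[OF that(1)]]
        ideal.I_r_closed[OF ideal[OF that(1)]] that(2) s by blast
    have P_eq: "P = carrier R \<inter> \<Inter>{Q \<in> S. s \<notin> Q}"
      unfolding eq using mem by auto
    \<comment> \<open>A prime that is a finite intersection of ideals contains one of them, and
      hence equals it.\<close>
    then obtain Q where "Q \<in> S" "s \<notin> Q" "Q \<subseteq> P"
      using primeideal.Inter_subset_prime[OF P, of "{Q \<in> S. s \<notin> Q}"] fin ideal by auto
    moreover have "P \<subseteq> Q" using P_eq calculation by auto
    ultimately show ?thesis by auto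
  qed
  moreover have "\<exists>s \<in> carrier R. P = {r \<in> carrier R. r \<otimes> s \<in> \<Inter>S}" if P: "P \<in> S" for P
  proof -
    \<comment> \<open>Incomparability supplies an \<open>s\<close> that lies in every member except
      \<open>P\<close>; the annihilator of its class is then \<open>P\<close>.\<close>
    have "\<not> (\<exists>Q \<in> S - {P}. Q \<subseteq> P)" using antichain P by auto
    with primeideal.Inter_subset_prime[OF prime[OF P], of "S - {P}"] fin ideal
    have "\<not> carrier R \<inter> \<Inter>(S - {P}) \<subseteq> P" by blast
    then obtain s where s: "s \<in> carrier R" "s \<in> \<Inter>(S - {P})" "s \<notin> P"
      by blast
    have "P = {r \<in> carrier R. r \<otimes> s \<in> \<Inter>S}"
    proof (intro equalityI subsetI)
      fix r assume r: "r \<in> P"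
      then have rc: "r \<in> carrier R" by (rule ideal.Icarr[OF ideal[OF P]])
      have "r \<otimes> s \<in> Q" if "Q \<in> S" for Q
        using ideal.I_r_closed[OF ideal[OF P] r s(1)] ideal.I_l_closed[OF ideal[OF that] _ rc, of s] s(2) that
        by (cases "Q = P") auto
      with rc show "r \<in> {r \<in> carrier R. r \<otimes> s \<in> \<Inter>S}" by blast
    next
      fix r assume "r \<in> {r \<in> carrier R. r \<otimes> s \<in> \<Inter>S}"
      then show "r \<in> P"
        using P primeideal.I_prime[OF prime[OF P] _ s(1), of r] s(3) by blast
    qed
    with s(1) show ?thesis by blast
  qed
  ultimately show ?thesis
    unfolding J.associated_primes_eq using prime by blast
qed

section \<open>Monomial ideals\<close>

lemma mpoly_ring_simps [simp]:
  "carrier (ring_of_type_algebra :: 'a::comm_ring_1 ring) = UNIV"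
  "x \<otimes>\<^bsub>ring_of_type_algebra\<^esub> y = x * y"
  "x \<oplus>\<^bsub>ring_of_type_algebra\<^esub> y = x + y"
  "\<one>\<^bsub>ring_of_type_algebra\<^esub> = 1"
  "\<zero>\<^bsub>ring_of_type_algebra\<^esub> = 0"
  for x y :: "'a::comm_ring_1"
  by (simp_all add: ring_of_type_algebra_def)

lemma ideal_ring_of_type_algebraI:
  fixes I :: "'a::comm_ring_1 set"
  assumes "0 \<in> I" "\<And>x y. x \<in> I \<Longrightarrow> y \<in> I \<Longrightarrow> x + y \<in> I" "\<And>x y. y \<in> I \<Longrightarrow> x * y \<in> I"
  shows "ideal I ring_of_type_algebra"
proof -
  interpret cring "ring_of_type_algebra :: 'a ring" by (rule cring_from_type_algebra)
  have neg: "\<ominus>\<^bsub>ring_of_type_algebra\<^esub> x = - x" for x :: 'a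
    by (rule minus_equality) auto
  show ?thesis
  proof (rule idealI)
    show "subgroup I (add_monoid ring_of_type_algebra)"
    proof (rule subgroup.intro)
      fix x assume "x \<in> I"
      then have "(- 1) * x \<in> I" by (rule assms(3))
      then show "inv\<^bsub>add_monoid ring_of_type_algebra\<^esub> x \<in> I"
        using neg[of x] by (simp add: a_inv_def)
    qed (use assms in auto)
    show "a \<otimes>\<^bsub>ring_of_type_algebra\<^esub> x \<in> I" if "a \<in> I" for a x
      using assms(3)[OF that, of x] by (simp add: mult.commute)
  qed (use assms in \<open>auto intro: ring_axioms\<close>)
qed

text \<open>An ideal whenever \<open>A\<close> is closed under adding exponents. Membership depends
  on the support only, so intersections, products and degrees reduce to exponent vectors.\<close>

definition monomial_span :: "('n \<Rightarrow>\<^sub>0 nat) set \<Rightarrow> ('n, 'k::field) mpoly set" where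
  "monomial_span A = {f. Poly_Mapping.keys f \<subseteq> A}"

lemma monomial_in_monomial_span [simp]: "monomial a \<in> monomial_span A \<longleftrightarrow> a \<in> A"
  by (simp add: monomial_def monomial_span_def)

lemma ideal_monomial_span:
  assumes "\<And>a b. a \<in> A \<Longrightarrow> b + a \<in> A"
  shows "ideal (monomial_span A) mpoly_ring"
proof (rule ideal_ring_of_type_algebraI)
  show "f + g \<in> monomial_span A"
    if "f \<in> monomial_span A" "g \<in> monomial_span A" for f g :: "('a, 'b) mpoly"
    using that keys_add[of f g] by (auto simp: monomial_span_def)
  show "f * g \<in> monomial_span A" if "g \<in> monomial_span A" for f g :: "('a, 'b) mpoly"
    using that keys_mult[of f g] assms by (fastforce simp: monomial_span_def)
qed (simp add: monomial_span_def)

lemma poly_mapping_eq_sum_single: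
  "f = (\<Sum>a\<in>Poly_Mapping.keys f. Poly_Mapping.single a (Poly_Mapping.lookup f a))"
  by (rule poly_mapping_eqI) (auto simp: lookup_sum lookup_single when_def in_keys_iff)

lemma monomial_span_subset:
  assumes "0 \<in> I" "\<And>f g. f \<in> I \<Longrightarrow> g \<in> I \<Longrightarrow> f + g \<in> I"
    and "\<And>a c. a \<in> A \<Longrightarrow> Poly_Mapping.single a c \<in> I"
  shows "monomial_span A \<subseteq> I"
proof
  fix f :: "('a, 'b) mpoly" assume "f \<in> monomial_span A"
  then have f: "Poly_Mapping.keys f \<subseteq> A" by (simp add: monomial_span_def)
  have "(\<Sum>a\<in>K. Poly_Mapping.single a (Poly_Mapping.lookup f a)) \<in> I" if "finite K" "K \<subseteq> A" for K
    using that assms by (induction K rule: finite_induct) auto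
  from this[OF finite_keys f] show "f \<in> I"
    by (simp flip: poly_mapping_eq_sum_single)
qed

text \<open>The hypotheses make \<open>A\<close> the upward closure of \<open>G\<close>, so each
  term with exponent in \<open>A\<close> is a multiple of a generator.\<close>

lemma monomial_span_generated:
  fixes A :: "('n \<Rightarrow>\<^sub>0 nat) set"
  assumes "G \<subseteq> A" and up: "\<And>a b. a \<in> A \<Longrightarrow> b + a \<in> A"
    and gen: "\<And>a. a \<in> A \<Longrightarrow> \<exists>g\<in>G. \<exists>b. a = b + g"
  shows "Idl\<^bsub>mpoly_ring\<^esub> (monomial ` G) = (monomial_span A :: ('n, 'k::field) mpoly set)"
proof -
  interpret R: cring "mpoly_ring :: ('n, 'k) mpoly ring" by (rule cring_from_type_algebra)
  interpret I: ideal "Idl\<^bsub>mpoly_ring\<^esub> (monomial ` G)" "mpoly_ring :: ('n, 'k) mpoly ring"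
    by (rule R.genideal_ideal) simp
  show ?thesis
  proof
    show "Idl\<^bsub>mpoly_ring\<^esub> (monomial ` G) \<subseteq> (monomial_span A :: ('n, 'k) mpoly set)"
      using assms(1) by (intro R.genideal_minimal ideal_monomial_span up) auto
    show "(monomial_span A :: ('n, 'k) mpoly set) \<subseteq> Idl\<^bsub>mpoly_ring\<^esub> (monomial ` G)"
    proof (rule monomial_span_subset)
      show "0 \<in> Idl\<^bsub>mpoly_ring\<^esub> (monomial ` G :: ('n, 'k) mpoly set)"
        using I.zero_closed by simp
      show "f + g \<in> Idl\<^bsub>mpoly_ring\<^esub> (monomial ` G)"
        if "f \<in> Idl\<^bsub>mpoly_ring\<^esub> (monomial ` G)" "g \<in> Idl\<^bsub>mpoly_ring\<^esub> (monomial ` G)"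
        for f g :: "('n, 'k) mpoly"
        using I.a_closed[OF that] by simp
      fix a and c :: 'k assume "a \<in> A"
      then obtain g b where g: "g \<in> G" "a = b + g" using gen by blast
      have "monomial g \<in> Idl\<^bsub>mpoly_ring\<^esub> (monomial ` G :: ('n, 'k) mpoly set)"
        using g(1) R.genideal_self[of "monomial ` G"] by auto
      from I.I_l_closed[OF this, of "Poly_Mapping.single b c"]
      show "Poly_Mapping.single a c \<in> Idl\<^bsub>mpoly_ring\<^esub> (monomial ` G)"
        by (simp add: g(2) monomial_def mult_single)
    qed
  qed
qed

section \<open>Prime monomial ideals\<close>

text \<open>Excludes cancellation: the convolution sum collapses to one summand. It is applied to
  leading exponents.\<close>

lemma lookup_mult_unique:
  fixes f g :: "('n, 'k::field) mpoly"
  assumes "\<And>a' b'. a' \<in> Poly_Mapping.keys f \<Longrightarrow> b' \<in> Poly_Mapping.keys g \<Longrightarrow>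
      a' + b' = a + b \<Longrightarrow> a' = a \<and> b' = b"
  shows "Poly_Mapping.lookup (f * g) (a + b) = Poly_Mapping.lookup f a * Poly_Mapping.lookup g b"
proof -
  have "Poly_Mapping.lookup (f * g) (a + b)
      = (\<Sum>p. (case p of (a', b') \<Rightarrow> Poly_Mapping.lookup f a' * Poly_Mapping.lookup g b' when a + b = a' + b'))"
    by (simp add: times_poly_mapping.rep_eq prod_fun_unfold_prod)
  also have "\<dots> = (\<Sum>p. (Poly_Mapping.lookup f a * Poly_Mapping.lookup g b when p = (a, b)))"
  proof (intro Sum_any.cong)
    fix p :: "('n \<Rightarrow>\<^sub>0 nat) \<times> ('n \<Rightarrow>\<^sub>0 nat)"
    obtain a' b' where p: "p = (a', b')" by (cases p)
    show "(case p of (a', b') \<Rightarrow> Poly_Mapping.lookup f a' * Poly_Mapping.lookup g b' when a + b = a' + b')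
        = (Poly_Mapping.lookup f a * Poly_Mapping.lookup g b when p = (a, b))"
    proof (cases "a + b = a' + b' \<and> p \<noteq> (a, b)")
      case True
      then have "a' \<notin> Poly_Mapping.keys f \<or> b' \<notin> Poly_Mapping.keys g"
        using assms[of a' b'] p by auto
      with True show ?thesis by (auto simp: p in_keys_iff)
    qed (auto simp: p when_def)
  qed
  finally show ?thesis by simp
qed

text \<open>Pulling back the lexicographic order along \<open>\<phi>\<close> gives a term order; the index type itself need
  not be ordered.\<close>

lemma term_order_exists:
  obtains \<phi> :: "('n::finite \<Rightarrow>\<^sub>0 nat) \<Rightarrow> (nat \<Rightarrow>\<^sub>0 nat)"
    where "inj \<phi>" "\<And>a b. \<phi> (a + b) = \<phi> a + \<phi> b"
proof -
  obtain e :: "'n \<Rightarrow> nat" where e: "inj e"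
    using finite_imp_inj_to_nat_seg[of "UNIV :: 'n set"] by auto
  define \<phi> :: "('n \<Rightarrow>\<^sub>0 nat) \<Rightarrow> (nat \<Rightarrow>\<^sub>0 nat)"
    where "\<phi> a = (\<Sum>i\<in>UNIV. Poly_Mapping.single (e i) (Poly_Mapping.lookup a i))" for a
  have "Poly_Mapping.lookup (\<phi> a) (e i) = Poly_Mapping.lookup a i" for a i
    unfolding \<phi>_def using e by (simp add: lookup_sum lookup_single when_def inj_eq)
  then have "inj \<phi>" by (metis injI poly_mapping_eqI)
  moreover have "\<phi> (a + b) = \<phi> a + \<phi> b" for a b
    by (simp add: \<phi>_def lookup_add single_add sum.distrib)
  ultimately show ?thesis using that by blast
qed

text \<open>Leading-term argument restricted to exponents outside \<open>A\<close>: the product of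
  the leading terms of two non-members survives, and its exponent is again outside
  \<open>A\<close>.\<close>

lemma primeideal_monomial_span:
  fixes A :: "('n::finite \<Rightarrow>\<^sub>0 nat) set"
  assumes prime: "\<And>a b. a + b \<in> A \<longleftrightarrow> a \<in> A \<or> b \<in> A" and "0 \<notin> A"
  shows "primeideal (monomial_span A) (mpoly_ring :: ('n, 'k::field) mpoly ring)"
proof (rule primeidealI)
  show "ideal (monomial_span A) (mpoly_ring :: ('n, 'k) mpoly ring)"
    by (rule ideal_monomial_span) (simp add: prime)
  show "cring (mpoly_ring :: ('n, 'k) mpoly ring)" by (rule cring_from_type_algebra)
  have "monomial 0 \<notin> (monomial_span A :: ('n, 'k) mpoly set)" using assms(2) by simp
  then show "carrier mpoly_ring \<noteq> (monomial_span A :: ('n, 'k) mpoly set)"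
    by (metis UNIV_I mpoly_ring_simps(1))
  obtain \<phi> :: "('n \<Rightarrow>\<^sub>0 nat) \<Rightarrow> (nat \<Rightarrow>\<^sub>0 nat)"
    where \<phi>: "inj \<phi>" "\<And>a b. \<phi> (a + b) = \<phi> a + \<phi> b"
    by (rule term_order_exists) blast
  have leading: "\<exists>a\<in>Poly_Mapping.keys f - A. \<forall>b\<in>Poly_Mapping.keys f - A. \<phi> b \<le> \<phi> a"
    if "f \<notin> monomial_span A" for f :: "('n, 'k) mpoly"
  proof -
    have ne: "\<phi> ` (Poly_Mapping.keys f - A) \<noteq> {}" using that by (auto simp: monomial_span_def)
    then have "Max (\<phi> ` (Poly_Mapping.keys f - A)) \<in> \<phi> ` (Poly_Mapping.keys f - A)" by (intro Max_in) auto
    then obtain a where a: "a \<in> Poly_Mapping.keys f - A" "Max (\<phi> ` (Poly_Mapping.keys f - A)) = \<phi> a" by auto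
    have "\<phi> b \<le> \<phi> a" if "b \<in> Poly_Mapping.keys f - A" for b
      unfolding a(2)[symmetric] using that by (intro Max_ge) auto
    with a(1) show ?thesis by blast
  qed
  fix f g :: "('n, 'k) mpoly"
  assume fg: "f \<otimes>\<^bsub>mpoly_ring\<^esub> g \<in> monomial_span A"
  show "f \<in> monomial_span A \<or> g \<in> monomial_span A"
  proof (rule ccontr)
    assume "\<not> ?thesis"
    then obtain a b where a: "a \<in> Poly_Mapping.keys f - A" "\<And>a'. a' \<in> Poly_Mapping.keys f - A \<Longrightarrow> \<phi> a' \<le> \<phi> a"
      and b: "b \<in> Poly_Mapping.keys g - A" "\<And>b'. b' \<in> Poly_Mapping.keys g - A \<Longrightarrow> \<phi> b' \<le> \<phi> b"
      using leading by meson
    have "Poly_Mapping.lookup (f * g) (a + b) = Poly_Mapping.lookup f a * Poly_Mapping.lookup g b"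
    proof (rule lookup_mult_unique)
      fix a' b' assume *: "a' \<in> Poly_Mapping.keys f" "b' \<in> Poly_Mapping.keys g" "a' + b' = a + b"
      \<comment> \<open>Since \<open>a + b\<close> is outside \<open>A\<close>, so are both summands
        of any other splitting. They are therefore bounded by the leading exponents, and equality of
        the sums forces equality of the parts.\<close>
      then have "a' \<notin> A" "b' \<notin> A" using prime[of a' b'] prime[of a b] a(1) b(1) by auto
      then have le: "\<phi> a' \<le> \<phi> a" "\<phi> b' \<le> \<phi> b" using a(2) b(2) * by auto
      moreover have "\<phi> a' + \<phi> b' = \<phi> a + \<phi> b" using *(3) by (metis \<phi>(2))
      ultimately have "\<phi> a' = \<phi> a" "\<phi> b' = \<phi> b"
        using add_less_le_mono[of "\<phi> a'" "\<phi> a" "\<phi> b'" "\<phi> b"]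
          add_le_less_mono[of "\<phi> a'" "\<phi> a" "\<phi> b'" "\<phi> b"] by fastforce+
      then show "a' = a \<and> b' = b" using \<phi>(1) by (simp add: inj_eq)
    qed
    then have "a + b \<in> Poly_Mapping.keys (f * g)" using a(1) b(1) by (simp add: in_keys_iff)
    moreover have "a + b \<notin> A" using prime a(1) b(1) by auto
    ultimately show False using fg by (auto simp: monomial_span_def)
  qed
qed

section \<open>Symbolic powers of cover ideals\<close>

definition exponent_weight :: "'n set \<Rightarrow> ('n \<Rightarrow>\<^sub>0 nat) \<Rightarrow> nat" where
  "exponent_weight F a = (\<Sum>i\<in>F. Poly_Mapping.lookup a i)"

lemma exponent_weight_add: "exponent_weight F (a + b) = exponent_weight F a + exponent_weight F b"
  by (simp add: exponent_weight_def lookup_add sum.distrib)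

lemma exponent_weight_single:
  "finite F \<Longrightarrow> i \<in> F \<Longrightarrow> exponent_weight F (Poly_Mapping.single i m) = m"
  by (simp add: exponent_weight_def lookup_single when_def)

lemma exponent_weight_pos:
  fixes F :: "'n::finite set"
  assumes "1 \<le> exponent_weight F a"
  obtains i b where "i \<in> F" "a = b + Poly_Mapping.single i 1"
proof -
  from assms obtain i where i: "i \<in> F" "Poly_Mapping.lookup a i \<noteq> 0"
    by (metis exponent_weight_def not_one_le_zero sum.neutral)
  moreover have "a = (a - Poly_Mapping.single i 1) + Poly_Mapping.single i 1"
    using i(2) by (intro poly_mapping_eqI) (auto simp: lookup_add lookup_minus lookup_single when_def)
  ultimately show ?thesis using that by blast
qed

text \<open>The \<open>l\<close>-th power of the prime generated by the variables of
  \<open>F\<close>, described by its exponents; \<open>Idl_variables\<close> and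
  \<open>face_prime_power_pow\<close> justify this reading.\<close>

definition face_prime_power :: "'n set \<Rightarrow> nat \<Rightarrow> ('n, 'k::field) mpoly set" where
  "face_prime_power F l = monomial_span {a. l \<le> exponent_weight F a}"

lemma ideal_face_prime_power: "ideal (face_prime_power F l) mpoly_ring"
  unfolding face_prime_power_def by (rule ideal_monomial_span) (simp add: exponent_weight_add)

lemma Idl_variables:
  fixes F :: "'n::finite set"
  shows "Idl\<^bsub>mpoly_ring\<^esub> (variable ` F) = (face_prime_power F 1 :: ('n, 'k::field) mpoly set)"
proof -
  have eq: "variable ` F = (monomial ` (\<lambda>i. Poly_Mapping.single i 1) ` F :: ('n, 'k) mpoly set)"
    by (simp add: image_image variable_def)
  show ?thesis
    unfolding eq face_prime_power_def
  proof (rule monomial_span_generated)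
    show "\<exists>g\<in>(\<lambda>i. Poly_Mapping.single i 1) ` F. \<exists>b. a = b + g"
      if a: "a \<in> {a. 1 \<le> exponent_weight F a}" for a
    proof -
      from a have "1 \<le> exponent_weight F a" by simp
      then obtain i b where "i \<in> F" "a = b + Poly_Mapping.single i 1"
        by (rule exponent_weight_pos)
      then show ?thesis by blast
    qed
  qed (auto simp: exponent_weight_add exponent_weight_single)
qed

lemma primeideal_face_prime_power:
  fixes F :: "'n::finite set"
  shows "primeideal (face_prime_power F 1) (mpoly_ring :: ('n, 'k::field) mpoly ring)"
  unfolding face_prime_power_def
proof (rule primeideal_monomial_span)
  show "a + b \<in> {a. 1 \<le> exponent_weight F a} \<longleftrightarrow>
      a \<in> {a. 1 \<le> exponent_weight F a} \<or> b \<in> {a. 1 \<le> exponent_weight F a}" for a b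
    by (auto simp: exponent_weight_add)
qed (simp add: exponent_weight_def)

text \<open>Weights add under products; conversely, splitting one variable of \<open>F\<close> off a
  monomial lowers its weight by exactly one.\<close>

lemma face_prime_power_Suc:
  fixes F :: "'n::finite set"
  shows "face_prime_power F l \<cdot>\<^bsub>mpoly_ring\<^esub> face_prime_power F 1
    = (face_prime_power F (Suc l) :: ('n, 'k::field) mpoly set)" (is "?L = ?R")
proof
  interpret S: ideal "face_prime_power F (Suc l)" "mpoly_ring :: ('n, 'k) mpoly ring"
    by (rule ideal_face_prime_power)
  show "?L \<subseteq> ?R"
  proof
    fix f :: "('n, 'k) mpoly" assume "f \<in> ?L"
    then show "f \<in> ?R"
    proof (induction rule: ideal_prod.induct)
      case (prod f g)
      have "Suc l \<le> exponent_weight F c" if c: "c \<in> Poly_Mapping.keys (f * g)" for c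
      proof -
        obtain a b where "a \<in> Poly_Mapping.keys f" "b \<in> Poly_Mapping.keys g" "c = a + b"
          using keys_mult[of f g] c by blast
        moreover from this have "l \<le> exponent_weight F a" "1 \<le> exponent_weight F b"
          using prod by (auto simp: face_prime_power_def monomial_span_def)
        ultimately show ?thesis by (simp add: exponent_weight_add)
      qed
      then show ?case by (auto simp: face_prime_power_def monomial_span_def)
    next
      case (sum f g)
      show ?case by (rule additive_subgroup.a_closed[OF S.is_additive_subgroup sum.IH])
    qed
  qed
  show "?R \<subseteq> ?L"
    unfolding face_prime_power_def[of F "Suc l"]
  proof (rule monomial_span_subset)
    have "0 \<in> (face_prime_power F m :: ('n, 'k) mpoly set)" for m
      by (simp add: face_prime_power_def monomial_span_def)
    from ideal_prod.prod[OF this this, of mpoly_ring] show "0 \<in> ?L" by simp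
    show "f + g \<in> ?L" if "f \<in> ?L" "g \<in> ?L" for f g
      using ideal_prod.sum[OF that] by simp
    fix a and c :: 'k assume "a \<in> {a. Suc l \<le> exponent_weight F a}"
    then have w: "Suc l \<le> exponent_weight F a" by simp
    then have "1 \<le> exponent_weight F a" by simp
    then obtain i b where ib: "i \<in> F" "a = b + Poly_Mapping.single i 1"
      by (rule exponent_weight_pos)
    have "l \<le> exponent_weight F b"
      using w ib by (simp add: exponent_weight_add exponent_weight_single)
    then have 1: "Poly_Mapping.single b c \<in> face_prime_power F l"
      by (auto simp: face_prime_power_def monomial_span_def)
    have 2: "Poly_Mapping.single (Poly_Mapping.single i 1) (1::'k) \<in> face_prime_power F 1"
      using ib(1) by (auto simp: face_prime_power_def monomial_span_def exponent_weight_single)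
    from ideal_prod.prod[OF 1 2, of mpoly_ring] show "Poly_Mapping.single a c \<in> ?L"
      by (simp add: ib(2) mult_single)
  qed
qed

lemma face_prime_power_pow:
  fixes F :: "'n::finite set"
  shows "face_prime_power F 1 [^]\<^bsub>ideals_set mpoly_ring\<^esub> l
    = (face_prime_power F l :: ('n, 'k::field) mpoly set)"
proof (induction l)
  case 0
  \<comment> \<open>The zeroth power is the whole ring, matching the empty condition of weight at
    least 0.\<close>
  then show ?case
    by (simp add: nat_pow_def ideals_set_def face_prime_power_def monomial_span_def)
next
  case (Suc l)
  then show ?case
    using face_prime_power_Suc[of F l, where 'k = 'k] by (simp add: nat_pow_def ideals_set_def)
qed

text \<open>Turns the maximality of facets into the incomparability that
  \<open>associated_primes_Inter\<close> requires. Testing on single variables suffices.\<close>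

lemma face_prime_power_subset_iff:
  fixes F G :: "'n::finite set"
  shows "(face_prime_power F 1 :: ('n, 'k::field) mpoly set) \<subseteq> face_prime_power G 1 \<longleftrightarrow> F \<subseteq> G"
proof
  assume le: "(face_prime_power F 1 :: ('n, 'k) mpoly set) \<subseteq> face_prime_power G 1"
  show "F \<subseteq> G"
  proof
    fix i assume "i \<in> F"
    then have "variable i \<in> (face_prime_power F 1 :: ('n, 'k) mpoly set)"
      by (simp add: variable_def face_prime_power_def exponent_weight_single)
    with le have "variable i \<in> (face_prime_power G 1 :: ('n, 'k) mpoly set)" by blast
    then have "1 \<le> exponent_weight G (Poly_Mapping.single i 1)"
      by (simp add: variable_def face_prime_power_def)
    then show "i \<in> G"
      by (auto simp: exponent_weight_def lookup_single when_def split: if_splits)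
  qed
next
  assume "F \<subseteq> G"
  then have "exponent_weight F a \<le> exponent_weight G a" for a
    unfolding exponent_weight_def by (intro sum_mono2) auto
  then show "(face_prime_power F 1 :: ('n, 'k) mpoly set) \<subseteq> face_prime_power G 1"
    unfolding face_prime_power_def monomial_span_def using order_trans by blast
qed

text \<open>The lattice points of the \<open>l\<close>-fold dilation of the symbolic polyhedron of
  the cover ideal.\<close>

definition cover_exponents :: "'n set set \<Rightarrow> nat \<Rightarrow> ('n \<Rightarrow>\<^sub>0 nat) set" where
  "cover_exponents \<Delta> l = {a. \<forall>F\<in>facets \<Delta>. l \<le> exponent_weight F a}"

lemma cover_ideal_eq:
  fixes \<Delta> :: "'n::finite set set"
  shows "cover_ideal \<Delta> = (monomial_span (cover_exponents \<Delta> 1) :: ('n, 'k::field) mpoly set)"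
  unfolding cover_ideal_def Idl_variables
  by (auto simp: face_prime_power_def monomial_span_def cover_exponents_def)

lemma symbolic_power_cover_ideal:
  fixes \<Delta> :: "'n::finite set set"
  assumes "facets \<Delta> \<noteq> {}"
  shows "symbolic_power mpoly_ring (cover_ideal \<Delta>) l
    = (monomial_span (cover_exponents \<Delta> l) :: ('n, 'k::field) mpoly set)"
proof -
  interpret R: cring "mpoly_ring :: ('n, 'k) mpoly ring" by (rule cring_from_type_algebra)
  have "associated_primes mpoly_ring (cover_ideal \<Delta> :: ('n, 'k) mpoly set)
      = (\<lambda>F. face_prime_power F 1) ` facets \<Delta>"
    unfolding cover_ideal_def Idl_variables
  proof (rule R.associated_primes_Inter)
    fix P Q :: "('n, 'k) mpoly set"
    assume "P \<in> (\<lambda>F. face_prime_power F 1) ` facets \<Delta>" "Q \<in> (\<lambda>F. face_prime_power F 1) ` facets \<Delta>"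
      "P \<subseteq> Q"
    then obtain F G where "F \<in> facets \<Delta>" "G \<in> facets \<Delta>" "P = face_prime_power F 1"
      "Q = face_prime_power G 1" "F \<subseteq> G"
      using face_prime_power_subset_iff by blast
    then show "P = Q" by (auto simp: facets_def)
  qed (use assms primeideal_face_prime_power in auto)
  then show ?thesis
    unfolding symbolic_power_def
    by (simp add: face_prime_power_pow del: One_nat_def)
      (auto simp: face_prime_power_def monomial_span_def cover_exponents_def)
qed

section \<open>Initial degrees\<close>

lemma total_degree_monomial [simp]:
  "total_degree (monomial a :: ('n::finite, 'k::field) mpoly) = exponent_weight UNIV a"
  by (simp add: total_degree_def monomial_def exponent_weight_def)

lemma exponent_weight_le_total_degree:
  assumes "a \<in> Poly_Mapping.keys f"
  shows "exponent_weight UNIV a \<le> total_degree f"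
  unfolding total_degree_def exponent_weight_def using assms by (intro Max_ge) auto

text \<open>\<open>A\<close> may be any set of exponents in \<open>L\<close> below which no degree
  falls. This covers a full monomial span, with all its exponents, and an ideal known only by its
  generators.\<close>

lemma initial_degree_attained:
  fixes L :: "('n::finite, 'k::field) mpoly set"
  assumes "A \<noteq> {}" and mem: "\<And>a. a \<in> A \<Longrightarrow> monomial a \<in> L"
    and dom: "\<And>f b. f \<in> L \<Longrightarrow> b \<in> Poly_Mapping.keys f \<Longrightarrow> \<exists>a\<in>A. exponent_weight UNIV a \<le> exponent_weight UNIV b"
  shows "(\<exists>a\<in>A. initial_degree L = exponent_weight UNIV a)
    \<and> (\<forall>a\<in>A. initial_degree L \<le> exponent_weight UNIV a)"
proof -
  have le: "initial_degree L \<le> exponent_weight UNIV a" if "a \<in> A" for a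
    unfolding initial_degree_def
  proof (rule Least_le)
    have "(monomial a :: ('n, 'k) mpoly) \<noteq> 0"
      by (metis keys_single keys_zero monomial_def insert_not_empty zero_neq_one)
    then show "\<exists>f\<in>L. f \<noteq> 0 \<and> total_degree f = exponent_weight UNIV a"
      using mem[OF that] by (intro bexI[of _ "monomial a"]) auto
  qed
  obtain a0 where a0: "a0 \<in> A" using assms(1) by blast
  have "(monomial a0 :: ('n, 'k) mpoly) \<noteq> 0"
    by (metis keys_single keys_zero monomial_def insert_not_empty zero_neq_one)
  then have "\<exists>d. \<exists>f\<in>L. f \<noteq> 0 \<and> total_degree f = d" using mem[OF a0] by blast
  then have "\<exists>f\<in>L. f \<noteq> 0 \<and> total_degree f = initial_degree L"
    unfolding initial_degree_def by (rule LeastI_ex)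
  then obtain f where f: "f \<in> L" "f \<noteq> 0" "total_degree f = initial_degree L" by blast
  \<comment> \<open>Any exponent of an \<open>f\<close> of least degree has weight at most that
    degree, so \<open>dom\<close> leads back to an element of \<open>A\<close>.\<close>
  then obtain b where b: "b \<in> Poly_Mapping.keys f"
    by (metis ex_in_conv in_keys_iff lookup_zero poly_mapping_eqI)
  with dom f(1) obtain a where "a \<in> A" "exponent_weight UNIV a \<le> exponent_weight UNIV b"
    by blast
  then have "exponent_weight UNIV a \<le> initial_degree L"
    using exponent_weight_le_total_degree[OF b] f(3) by simp
  with \<open>a \<in> A\<close> le show ?thesis by (meson le_antisym)
qed

lemma initial_degree_monomial_span:
  fixes A :: "('n::finite \<Rightarrow>\<^sub>0 nat) set"
  assumes "A \<noteq> {}"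
  shows "\<exists>a\<in>A. initial_degree (monomial_span A :: ('n, 'k::field) mpoly set) = exponent_weight UNIV a"
    and "\<And>a. a \<in> A \<Longrightarrow>
      initial_degree (monomial_span A :: ('n, 'k) mpoly set) \<le> exponent_weight UNIV a"
  using initial_degree_attained[OF assms, of "monomial_span A :: ('n, 'k) mpoly set"]
  by (auto simp: monomial_span_def monomial_def)

section \<open>Degrees of the cover ideal and of its squarefree parts\<close>

text \<open>With \<open>q = 1\<close> these are the squarefree exponents; larger \<open>q\<close>
  gives the test monomials that bound the Waldschmidt constant from above.\<close>

definition set_exponent :: "'n::finite set \<Rightarrow> nat \<Rightarrow> 'n \<Rightarrow>\<^sub>0 nat" where
  "set_exponent S q = Abs_poly_mapping (\<lambda>i. if i \<in> S then q else 0)"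

lemma lookup_set_exponent [simp]:
  "Poly_Mapping.lookup (set_exponent S q) i = (if i \<in> S then q else 0)"
  by (simp add: set_exponent_def)

lemma exponent_weight_set_exponent [simp]:
  "exponent_weight F (set_exponent S q) = q * card (S \<inter> F)"
  by (simp add: exponent_weight_def sum.If_cases Int_commute)

lemma set_exponent_in_cover_exponents:
  "is_cover \<Delta> j S \<Longrightarrow> l \<le> q * j \<Longrightarrow> set_exponent S q \<in> cover_exponents \<Delta> l"
  by (auto simp: is_cover_def cover_exponents_def intro: order_trans mult_le_mono2)

lemma is_cover_UNIV:
  "matroid \<Delta> \<Longrightarrow> j \<le> complex_rank \<Delta> \<Longrightarrow> is_cover \<Delta> j UNIV"
  by (simp add: is_cover_def facets_of_matroid)

text \<open>The least degree is attained on a squarefree generator, and such a generator is the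
  indicator vector of a cover.\<close>

lemma initial_degree_squarefree_monomial_ideal:
  fixes \<Delta> :: "'n::finite set set"
  assumes "matroid \<Delta>" "j \<le> complex_rank \<Delta>"
  shows "\<exists>S. is_cover \<Delta> j S \<and>
      initial_degree (squarefree_monomial_ideal j (cover_ideal \<Delta>) :: ('n, 'k::field) mpoly set) = card S"
    and "\<And>S. is_cover \<Delta> j S \<Longrightarrow>
      initial_degree (squarefree_monomial_ideal j (cover_ideal \<Delta>) :: ('n, 'k) mpoly set) \<le> card S"
proof -
  define A where "A = {a \<in> cover_exponents \<Delta> j. squarefree_exponent a}"
  define L :: "('n, 'k) mpoly set" where "L = squarefree_monomial_ideal j (cover_ideal \<Delta>)"
  have L: "L = monomial_span {b + a | a b. a \<in> A}"
  proof -
    have "{monomial a | a. squarefree_exponent a \<and>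
        monomial a \<in> symbolic_power mpoly_ring (cover_ideal \<Delta> :: ('n, 'k) mpoly set) j}
        = (monomial ` A :: ('n, 'k) mpoly set)"
      by (auto simp: symbolic_power_cover_ideal[OF facets_nonempty[OF assms(1)]] A_def)
    then have "L = Idl\<^bsub>mpoly_ring\<^esub> (monomial ` A)"
      by (simp add: L_def squarefree_monomial_ideal_def)
    also have "\<dots> = monomial_span {b + a | a b. a \<in> A}"
    proof (rule monomial_span_generated)
      show "A \<subseteq> {b + a | a b. a \<in> A}" by clarsimp (metis add_0)
      show "b' + a' \<in> {b + a | a b. a \<in> A}" if "a' \<in> {b + a | a b. a \<in> A}" for a' b'
        using that by clarsimp (metis add.assoc)
    qed auto
    finally show ?thesis .
  qed
  have cover_A: "set_exponent S 1 \<in> A" if "is_cover \<Delta> j S" for S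
    using set_exponent_in_cover_exponents[OF that, of j 1]
    by (simp add: A_def squarefree_exponent_def)
  have "A \<noteq> {}" using cover_A[OF is_cover_UNIV[OF assms]] by blast
  then have "(\<exists>a\<in>A. initial_degree L = exponent_weight UNIV a)
    \<and> (\<forall>a\<in>A. initial_degree L \<le> exponent_weight UNIV a)"
  proof (rule initial_degree_attained)
    show "monomial a \<in> L" if "a \<in> A" for a
      unfolding L monomial_in_monomial_span using that by clarsimp (metis add_0)
    show "\<exists>a\<in>A. exponent_weight UNIV a \<le> exponent_weight UNIV b"
      if "f \<in> L" "b \<in> Poly_Mapping.keys f" for f b
    proof -
      obtain a b' where "a \<in> A" "b = b' + a" using \<open>f \<in> L\<close> \<open>b \<in> Poly_Mapping.keys f\<close>
        by (auto simp: L monomial_span_def)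
      then show ?thesis by (intro bexI[of _ a]) (simp_all add: exponent_weight_add)
    qed
  qed
  then obtain a where a: "a \<in> A" "initial_degree L = exponent_weight UNIV a"
    and le: "\<And>a. a \<in> A \<Longrightarrow> initial_degree L \<le> exponent_weight UNIV a" by blast
  define S where "S = {i. Poly_Mapping.lookup a i = 1}"
  have "Poly_Mapping.lookup a i = (if i \<in> S then 1 else 0)" for i
    using a(1) by (auto simp: A_def squarefree_exponent_def S_def le_Suc_eq)
  then have a_eq: "a = set_exponent S 1" by (intro poly_mapping_eqI) simp
  have "is_cover \<Delta> j S"
    using a(1) by (simp add: A_def cover_exponents_def is_cover_def a_eq)
  with a(2) show "\<exists>S. is_cover \<Delta> j S \<and>
      initial_degree (squarefree_monomial_ideal j (cover_ideal \<Delta>) :: ('n, 'k) mpoly set) = card S"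
    unfolding L_def[symmetric] by (intro exI[of _ S]) (simp add: a_eq)
  show "initial_degree (squarefree_monomial_ideal j (cover_ideal \<Delta>) :: ('n, 'k) mpoly set) \<le> card S"
    if "is_cover \<Delta> j S" for S
    unfolding L_def[symmetric] using le[OF cover_A[OF that]] by simp
qed

text \<open>Weight at least 1 on a basis only asks for one positive entry there. Replacing an
  exponent by its support therefore keeps it in the ideal without raising the degree.\<close>

lemma initial_degree_cover_ideal:
  fixes \<Delta> :: "'n::finite set set"
  assumes "matroid \<Delta>" "loopless \<Delta>"
  shows "\<exists>S. is_cover \<Delta> 1 S \<and> initial_degree (cover_ideal \<Delta> :: ('n, 'k::field) mpoly set) = card S"
    and "\<And>S. is_cover \<Delta> 1 S \<Longrightarrow> initial_degree (cover_ideal \<Delta> :: ('n, 'k) mpoly set) \<le> card S"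
proof -
  let ?A = "cover_exponents \<Delta> 1"
  have cover_A: "set_exponent S 1 \<in> ?A" if "is_cover \<Delta> 1 S" for S
    by (rule set_exponent_in_cover_exponents[OF that]) simp
  have ne: "?A \<noteq> {}"
    using cover_A[OF is_cover_UNIV[OF assms(1) loopless_rank_pos[OF assms(2)]]] by blast
  show le: "initial_degree (cover_ideal \<Delta> :: ('n, 'k) mpoly set) \<le> card S" if "is_cover \<Delta> 1 S" for S
    using initial_degree_monomial_span(2)[OF ne cover_A[OF that], where 'k = 'k]
    by (simp add: cover_ideal_eq)
  obtain a where a: "a \<in> ?A"
    "initial_degree (cover_ideal \<Delta> :: ('n, 'k) mpoly set) = exponent_weight UNIV a"
    using initial_degree_monomial_span(1)[OF ne, where 'k = 'k] by (auto simp: cover_ideal_eq)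
  define S where "S = {i. 1 \<le> Poly_Mapping.lookup a i}"
  have "is_cover \<Delta> 1 S"
    unfolding is_cover_def
  proof
    fix F assume "F \<in> facets \<Delta>"
    with a(1) have "1 \<le> exponent_weight F a" by (simp add: cover_exponents_def)
    then obtain i b where "i \<in> F" "a = b + Poly_Mapping.single i 1"
      by (rule exponent_weight_pos)
    then have "i \<in> S \<inter> F" by (simp add: S_def lookup_add)
    then show "1 \<le> card (S \<inter> F)" by (metis One_nat_def Suc_leI card_gt_0_iff empty_iff finite)
  qed
  moreover have "card S \<le> exponent_weight UNIV a"
  proof -
    have "card S = exponent_weight UNIV (set_exponent S 1)" by simp
    also have "\<dots> \<le> exponent_weight UNIV a"
      unfolding exponent_weight_def by (intro sum_mono) (simp add: S_def)
    finally show ?thesis .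
  qed
  ultimately show "\<exists>S. is_cover \<Delta> 1 S \<and> initial_degree (cover_ideal \<Delta> :: ('n, 'k) mpoly set) = card S"
    using le a(2) by (metis le_antisym)
qed

section \<open>The Waldschmidt constant\<close>

text \<open>A sandwich: \<open>weighted_cover_bound\<close> gives the lower bound for every positive
  \<open>l\<close>, and multiples of the indicator of the optimal cover \<open>S\<close> give an
  upper bound with the same limit.\<close>

lemma waldschmidt_constant_cover_ideal:
  fixes \<Delta> :: "'n::finite set set"
  assumes "matroid \<Delta>"
    and j: "1 \<le> j" and S: "is_cover \<Delta> j S"
    and min: "\<And>i T. 1 \<le> i \<Longrightarrow> i \<le> complex_rank \<Delta> \<Longrightarrow> is_cover \<Delta> i T \<Longrightarrow>
      real (card S) / real j * real i \<le> real (card T)"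
  shows "waldschmidt_constant (cover_ideal \<Delta> :: ('n, 'k::field) mpoly set) = real (card S) / real j"
proof -
  define m where "m = real (card S) / real j"
  define d where "d l = initial_degree (symbolic_power mpoly_ring (cover_ideal \<Delta> :: ('n, 'k) mpoly set) l)" for l
  have d_eq: "d l = initial_degree (monomial_span (cover_exponents \<Delta> l) :: ('n, 'k) mpoly set)" for l
    by (simp add: d_def symbolic_power_cover_ideal[OF facets_nonempty[OF assms(1)]])
  \<comment> \<open>Taking \<open>l div j + 1\<close> copies of \<open>S\<close> reaches weight
    \<open>l\<close> on every basis. Rounding up costs at most \<open>card S\<close> in degree,
    which vanishes after division by \<open>l\<close>.\<close>
  have q: "l \<le> (l div j + 1) * j" for l
    using j by (simp add: less_imp_le dividend_less_div_times)
  have bounds: "m \<le> real (d l) / real l \<and> real (d l) / real l \<le> m + real (card S) / real l"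
    if "l \<ge> 1" for l
  proof
    have mem: "set_exponent S (l div j + 1) \<in> cover_exponents \<Delta> l"
      by (rule set_exponent_in_cover_exponents[OF S q])
    then have ne: "cover_exponents \<Delta> l \<noteq> {}" by blast
    obtain a where a: "a \<in> cover_exponents \<Delta> l" "d l = exponent_weight UNIV a"
      using initial_degree_monomial_span(1)[OF ne, where 'k = 'k] unfolding d_eq by blast
    have "m * real l \<le> real (sum (Poly_Mapping.lookup a) UNIV)"
    proof (rule weighted_cover_bound[OF assms(1)])
      show "m * real i \<le> real (card T)"
        if "1 \<le> i" "i \<le> complex_rank \<Delta>" "is_cover \<Delta> i T" for i T
        using min[OF that] by (simp add: m_def)
      show "l \<le> sum (Poly_Mapping.lookup a) F" if "F \<in> facets \<Delta>" for F
        using a(1) that by (auto simp: cover_exponents_def exponent_weight_def)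
    qed (simp add: m_def)
    then show "m \<le> real (d l) / real l"
      using \<open>l \<ge> 1\<close> by (simp add: a(2) exponent_weight_def pos_le_divide_eq)
    have div: "real (l div j) \<le> real l / real j"
    proof -
      have "real (l div j * j) \<le> real l" by (intro of_nat_mono div_times_less_eq_dividend)
      then show ?thesis using j by (simp add: pos_le_divide_eq)
    qed
    have "d l \<le> (l div j + 1) * card S"
      using initial_degree_monomial_span(2)[OF ne mem, where 'k = 'k] unfolding d_eq by simp
    then have "real (d l) \<le> real ((l div j + 1) * card S)" by (rule of_nat_mono)
    also have "\<dots> = (real (l div j) + 1) * real (card S)" by (simp add: algebra_simps)
    also have "\<dots> \<le> (real l / real j + 1) * real (card S)"
      using div by (intro mult_right_mono add_right_mono) auto
    also have "\<dots> = (m + real (card S) / real l) * real l"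
      using \<open>l \<ge> 1\<close> by (simp add: m_def distrib_right)
    finally show "real (d l) / real l \<le> m + real (card S) / real l"
      using \<open>l \<ge> 1\<close> by (simp add: pos_divide_le_eq)
  qed
  have "(\<lambda>l. real (d l) / real l) \<longlonglongrightarrow> m"
  proof (rule tendsto_sandwich)
    show "(\<lambda>l. m) \<longlonglongrightarrow> m" by simp
    have "(\<lambda>l. m + real (card S) / real l) \<longlonglongrightarrow> m + 0"
      by (intro tendsto_add tendsto_const lim_const_over_n)
    then show "(\<lambda>l. m + real (card S) / real l) \<longlonglongrightarrow> m" by simp
  qed (use bounds in \<open>auto intro: eventually_sequentiallyI[of 1]\<close>)
  then show ?thesis
    unfolding waldschmidt_constant_def d_def[symmetric] m_def[symmetric] by (rule limI)
qed

theorem proposition7p7: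
  fixes \<Delta> :: "'n::finite set set"
    and J :: "('n, 'k::field) mpoly set"
    and c u :: nat
  assumes "matroid \<Delta>"
    and "loopless \<Delta>"
    and "complex_rank \<Delta> = c"
    and "\<not> is_uniform_matroid \<Delta>"
    and "J = cover_ideal \<Delta>"
    and "uniformity_threshold \<Delta> = enat u"
  shows "waldschmidt_constant J =
    Min ({real (initial_degree J)}
      \<union> {real (initial_degree (squarefree_monomial_ideal l J)) / real l | l. l \<in> {2..u - 1}}
      \<union> {real (card (UNIV :: 'n set)) / real c})"
    (is "_ = Min ?M")
proof -
  note u = uniformity_threshold_attained[OF assms(6), unfolded assms(3)]
  have c: "1 \<le> c" using loopless_rank_pos[OF assms(2)] assms(3) by simp
  have fin: "finite ?M" by (auto simp: setcompr_eq_image)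
  \<comment> \<open>Each entry of the minimum is the ratio of a cover; \<open>n / c\<close> comes
    from the whole ground set, which meets every basis in \<open>c\<close> elements.\<close>
  have attained: "\<exists>j S. 1 \<le> j \<and> is_cover \<Delta> j S \<and> x = real (card S) / real j" if x: "x \<in> ?M" for x
  proof -
    consider "x = real (initial_degree J)"
      | l where "2 \<le> l" "l \<le> u - 1" "x = real (initial_degree (squarefree_monomial_ideal l J)) / real l"
      | "x = real (card (UNIV :: 'n set)) / real c"
      using x by auto
    then show ?thesis
    proof cases
      case 1
      then show ?thesis
        using initial_degree_cover_ideal(1)[OF assms(1,2), where 'k = 'k] assms(5)
        by (intro exI[of _ 1]) auto
    next
      case 2
      then have "l \<le> complex_rank \<Delta>" using u(2) assms(3) by simp
      then show ?thesis
        using initial_degree_squarefree_monomial_ideal(1)[OF assms(1), of l, where 'k = 'k] 2 assms(5)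
        by (intro exI[of _ l]) auto
    next
      case 3
      then show ?thesis using is_cover_UNIV[OF assms(1), of c] c assms(3) by blast
    qed
  qed
  \<comment> \<open>No cover has a smaller ratio: multiplicities below \<open>u\<close> have their
    own entry in \<open>?M\<close>, and those from \<open>u\<close> on are dominated by
    \<open>n / c\<close>.\<close>
  have minimal: "Min ?M * real i \<le> real (card T)"
    if i: "1 \<le> i" "i \<le> complex_rank \<Delta>" and T: "is_cover \<Delta> i T" for i T
  proof -
    have "\<exists>x\<in>?M. x * real i \<le> real (card T)"
    proof (cases "u \<le> i")
      case True
      have "card (UNIV :: 'n set) + i \<le> card T + complex_rank \<Delta>"
        using u i True assms(3) T by (intro cover_card_above_threshold[OF assms(1), of u]) auto
      then have 1: "real (card (UNIV :: 'n set)) + real i \<le> real (card T) + real c"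
        using assms(3) by linarith
      have "c \<le> card (UNIV :: 'n set)"
        unfolding assms(3)[symmetric] complex_rank_def
        using assms(1) by (subst Max_le_iff) (auto simp: matroid_def simplicial_complex_def card_mono)
      \<comment> \<open>Expanding \<open>(n - c) (c - i) \<ge> 0\<close> gives
        \<open>n i \<le> (n + i - c) c\<close>, that is,
        \<open>n / c \<le> (n - c + i) / i\<close>.\<close>
      then have "0 \<le> (real (card (UNIV :: 'n set)) - real c) * (real c - real i)"
        using i(2) assms(3) by (intro mult_nonneg_nonneg) auto
      then have "real (card (UNIV :: 'n set)) * real i
          \<le> (real (card (UNIV :: 'n set)) + real i - real c) * real c"
        by (simp add: algebra_simps)
      also have "\<dots> \<le> real (card T) * real c"
        using 1 by (intro mult_right_mono) auto
      finally have "real (card (UNIV :: 'n set)) / real c * real i \<le> real (card T)"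
        using c by (simp add: field_simps)
      then show ?thesis by blast
    next
      case False
      show ?thesis
      \<comment> \<open>Multiplicity 1 is represented by \<alpha>(J) itself; the squarefree entries
        start at 2.\<close>
      proof (cases "i = 1")
        case True
        then have "real (initial_degree J) * real i \<le> real (card T)"
          using initial_degree_cover_ideal(2)[OF assms(1,2), of T, where 'k = 'k] T assms(5) by simp
        then show ?thesis by blast
      next
        case i1: False
        then have "i \<in> {2..u - 1}" using False i by auto
        moreover have "real (initial_degree (squarefree_monomial_ideal i J)) / real i * real i \<le> real (card T)"
          using initial_degree_squarefree_monomial_ideal(2)[OF assms(1) i(2) T, where 'k = 'k] i(1)
          by (simp add: assms(5))
        ultimately show ?thesis by blast
      qed
    qed
    then obtain x where "x \<in> ?M" "x * real i \<le> real (card T)" by blast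
    moreover have "Min ?M * real i \<le> x * real i"
      using fin \<open>x \<in> ?M\<close> by (intro mult_right_mono Min_le) auto
    ultimately show ?thesis by linarith
  qed
  \<comment> \<open>The minimum is thus the ratio of an actual cover, which serves as the optimal
    cover in the limit computation.\<close>
  have "Min ?M \<in> ?M" using fin by (intro Min_in) auto
  then obtain j S where jS: "1 \<le> j" "is_cover \<Delta> j S" "Min ?M = real (card S) / real j"
    using attained by blast
  have "waldschmidt_constant (cover_ideal \<Delta> :: ('n, 'k) mpoly set) = real (card S) / real j"
    using minimal by (intro waldschmidt_constant_cover_ideal[OF assms(1) jS(1,2)])
      (simp flip: jS(3))
  with jS(3) assms(5) show ?thesis by simp
qed

end
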